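(* Let $M$ be a totally umbilical slant submanifold of a Kenmotsu manifold $(\bar M,\phi,\xi,\eta,g)$, and let $H$ be the mean curvature vector of $M$ in $\bar M$. Then at least one of the following statements is true: (i) $M$ is invariant; (ii) $M$ is anti-invariant; (iii) $M$ is totally geodesic; (iv) $\dim M=1$; (v) if $M$ is proper slant, then $H\in\Gamma(\mu)$, where $\mu$ is the orthogonal complement of $F(TM)$ in the normal bundle $T^\perp M$.
   Context: An almost contact metric manifold is a $(2n+1)$-dimensional Riemannian manifold $(\bar M,g)$ with an endomorphism $\phi$ of $T\bar M$, a vector field $\xi$ (the structure vector field) and a $1$-form $\eta$ satisfying $$\phi^2=-I+\eta\otimes\xi,\quad \eta(\xi)=1,\quad \phi(\xi)=0,\quad \eta\circ\phi=0,$$ $$g(\phi X,\phi Y)=g(X,Y)-\eta(X)\eta(Y),\quad \eta(X)=g(X,\xi)$$ for all $X,Y$ tangent to $\bar M$. It is a Kenmotsu manifold if, with $\bar\nabla$ the Levi-Civita connection of $g$, $$(\bar\nabla_X\phi)Y=g(\phi X,Y)\xi-\eta(Y)\phi X,\qquad \bar\nabla_X\xi=X-\eta(X)\xi$$ for all vector fields $X,Y$ on $\bar M$, where $(\bar\nabla_X\phi)Y=\bar\nabla_X\phi Y-\phi\bar\nabla_XY$. Let $M$ be a submanifold of $\bar M$ with the induced metric (also denoted $g$), tangent bundle $TM$, normal bundle $T^\perp M$, and second fundamental form $h$, defined by the Gauss formula $\bar\nabla_XY=\nabla_XY+h(X,Y)$ for $X,Y\in\Gamma(TM)$, with $\nabla$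 the induced connection. The submanifold $M$ is totally umbilical if $h(X,Y)=g(X,Y)H$ for all $X,Y\in\Gamma(TM)$, where $H$ is the mean curvature vector of $M$; it is totally geodesic if $h=0$. For $X\in\Gamma(TM)$ write $\phi X=TX+FX$ with $TX$ tangent and $FX$ normal to $M$. $M$ is slant if $\xi$ is tangent to $M$ and, for all $x\in M$ and $X\in T_xM-\langle\xi\rangle$, the angle between $\phi X$ and $T_xM$ is a constant $\theta\in[0,\pi/2]$ (independent of $x$ and $X$), called the slant angle. $M$ is invariant if $FX=0$ for all $X\in\Gamma(TM)$ (slant angle $0$), anti-invariant if $TX=0$ for all $X\in\Gamma(TM)$ (slant angle $\pi/2$), and proper slant if it is slant and neither invariant nor anti-invariant. For a slant submanifold the normal bundle decomposes orthogonally as $T^\perp M=F(TM)\oplus\mu$, where $\mu$ is a $\phi$-invariant subbundle (the invariant normal subbundle). *)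

theory Defs
  imports "HOL-Analysis.Analysis" "HOL-Library.Function_Algebras"
begin

instantiation "fun" :: (type, real_vector) real_vector
begin

definition scaleR_fun :: "real \<Rightarrow> ('a \<Rightarrow> 'b) \<Rightarrow> 'a \<Rightarrow> 'b"
  where "scaleR_fun r f = (\<lambda>x. r *\<^sub>R f x)"

instance
  by standard
    (simp_all add: scaleR_fun_def fun_eq_iff scaleR_add_right scaleR_add_left)

end

fun times_differentiable_on ::
    "nat \<Rightarrow> 'e::real_normed_vector set \<Rightarrow> ('e \<Rightarrow> 'f::real_normed_vector) \<Rightarrow> bool"
  where
    "times_differentiable_on 0 S f \<longleftrightarrow> continuous_on S f"
  | "times_differentiable_on (Suc k) S f \<longleftrightarrow>
       (\<forall>x\<in>S. f differentiable (at x)) \<and>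
       (\<forall>v. times_differentiable_on k S (\<lambda>x. frechet_derivative f (at x) v))"

text \<open>Meant for open \<open>S\<close> in a finite-dimensional space: \<open>f\<close> is of class \<open>C\<^sup>\<infinity>\<close> on \<open>S\<close>.\<close>

definition smooth_on :: "'e::real_normed_vector set \<Rightarrow> ('e \<Rightarrow> 'f::real_normed_vector) \<Rightarrow> bool"
  where "smooth_on S f \<longleftrightarrow> (\<forall>k. times_differentiable_on k S f)"

text \<open>A chart is a pair of an open domain and a coordinate map; the manifold is the whole
  type \<open>'a\<close>, and its dimension is \<open>DIM('e)\<close>.\<close>

type_synonym ('a, 'e) atlas = "('a set \<times> ('a \<Rightarrow> 'e)) set"

definition smooth_manifold ::
    "('a::{t2_space, second_countable_topology}, 'e::euclidean_space) atlas \<Rightarrow> bool"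
  where "smooth_manifold A \<longleftrightarrow>
    (\<forall>(U, c)\<in>A. open U \<and> open (c ` U) \<and> homeomorphism U (c ` U) c (inv_into U c)) \<and>
    (\<Union>(U, c)\<in>A. U) = UNIV \<and>
    (\<forall>(U, c)\<in>A. \<forall>(V, d)\<in>A. smooth_on (c ` (U \<inter> V)) (d \<circ> inv_into U c))"

definition smooth_functions :: "('a, 'e::euclidean_space) atlas \<Rightarrow> ('a \<Rightarrow> real) set"
  where "smooth_functions A = {u. \<forall>(U, c)\<in>A. smooth_on (c ` U) (u \<circ> inv_into U c)}"

definition smooth_map ::
    "('b::topological_space, 'm::euclidean_space) atlas \<Rightarrow>
     ('a::topological_space, 'e::euclidean_space) atlas \<Rightarrow> ('b \<Rightarrow> 'a) \<Rightarrow> bool"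
  where "smooth_map B A f \<longleftrightarrow> continuous_on UNIV f \<and>
    (\<forall>(U, c)\<in>B. \<forall>(V, d)\<in>A. smooth_on (c ` (U \<inter> f -` V)) (d \<circ> f \<circ> inv_into U c))"

definition linear_on_set :: "'v::real_vector set \<Rightarrow> ('v \<Rightarrow> 'w::real_vector) \<Rightarrow> bool"
  where "linear_on_set S L \<longleftrightarrow>
    (\<forall>x\<in>S. \<forall>y\<in>S. L (x + y) = L x + L y) \<and> (\<forall>r. \<forall>x\<in>S. L (r *\<^sub>R x) = r *\<^sub>R L x)"

text \<open>Tangent vectors at \<open>p\<close> are the derivations at \<open>p\<close> of the algebra of smooth functions.
  They are normalised to vanish outside that algebra, so that equality of tangent vectors is
  equality of HOL functions.\<close>

type_synonym 'a tvec = "('a \<Rightarrow> real) \<Rightarrow> real"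

definition tangent_space :: "('a, 'e::euclidean_space) atlas \<Rightarrow> 'a \<Rightarrow> 'a tvec set"
  where "tangent_space A p = {v.
    linear_on_set (smooth_functions A) v \<and>
    (\<forall>u\<in>smooth_functions A. \<forall>w\<in>smooth_functions A. v (u * w) = v u * w p + u p * v w) \<and>
    (\<forall>u. u \<notin> smooth_functions A \<longrightarrow> v u = 0)}"

definition vector_fields :: "('a, 'e::euclidean_space) atlas \<Rightarrow> ('a \<Rightarrow> 'a tvec) set"
  where "vector_fields A = {X.
    (\<forall>p. X p \<in> tangent_space A p) \<and>
    (\<forall>u\<in>smooth_functions A. (\<lambda>p. X p u) \<in> smooth_functions A)}"

definition lie_bracket :: "('a \<Rightarrow> 'a tvec) \<Rightarrow> ('a \<Rightarrow> 'a tvec) \<Rightarrow> 'a \<Rightarrow> 'a tvec"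
  where "lie_bracket X Y = (\<lambda>p u. X p (\<lambda>q. Y q u) - Y p (\<lambda>q. X q u))"

definition differential ::
    "('b, 'm::euclidean_space) atlas \<Rightarrow> ('a, 'e::euclidean_space) atlas \<Rightarrow> ('b \<Rightarrow> 'a) \<Rightarrow>
     'b tvec \<Rightarrow> 'a tvec"
  where "differential B A f v = (\<lambda>u. if u \<in> smooth_functions A then v (u \<circ> f) else 0)"

definition riemannian_metric ::
    "('a, 'e::euclidean_space) atlas \<Rightarrow> ('a \<Rightarrow> 'a tvec \<Rightarrow> 'a tvec \<Rightarrow> real) \<Rightarrow> bool"
  where "riemannian_metric A g \<longleftrightarrow>
    (\<forall>p. \<forall>v\<in>tangent_space A p.
       linear_on_set (tangent_space A p) (g p v) \<and>
       (\<forall>w\<in>tangent_space A p. g p v w = g p w v) \<and>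
       (v \<noteq> 0 \<longrightarrow> g p v v > 0)) \<and>
    (\<forall>X\<in>vector_fields A. \<forall>Y\<in>vector_fields A. (\<lambda>p. g p (X p) (Y p)) \<in> smooth_functions A)"

definition affine_connection ::
    "('a, 'e::euclidean_space) atlas \<Rightarrow>
     (('a \<Rightarrow> 'a tvec) \<Rightarrow> ('a \<Rightarrow> 'a tvec) \<Rightarrow> 'a \<Rightarrow> 'a tvec) \<Rightarrow> bool"
  where "affine_connection A D \<longleftrightarrow>
    (\<forall>X\<in>vector_fields A. \<forall>Y\<in>vector_fields A. \<forall>Z\<in>vector_fields A. \<forall>u\<in>smooth_functions A.
       D X Y \<in> vector_fields A \<and>
       D (X + Y) Z = D X Z + D Y Z \<and>
       D (\<lambda>p. u p *\<^sub>R X p) Y = (\<lambda>p. u p *\<^sub>R D X Y p) \<and>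
       D X (Y + Z) = D X Y + D X Z \<and>
       D X (\<lambda>p. u p *\<^sub>R Y p) = (\<lambda>p. X p u *\<^sub>R Y p + u p *\<^sub>R D X Y p))"

definition levi_civita ::
    "('a, 'e::euclidean_space) atlas \<Rightarrow> ('a \<Rightarrow> 'a tvec \<Rightarrow> 'a tvec \<Rightarrow> real) \<Rightarrow>
     (('a \<Rightarrow> 'a tvec) \<Rightarrow> ('a \<Rightarrow> 'a tvec) \<Rightarrow> 'a \<Rightarrow> 'a tvec) \<Rightarrow> bool"
  where "levi_civita A g D \<longleftrightarrow> affine_connection A D \<and>
    (\<forall>X\<in>vector_fields A. \<forall>Y\<in>vector_fields A. D X Y - D Y X = lie_bracket X Y) \<and>
    (\<forall>X\<in>vector_fields A. \<forall>Y\<in>vector_fields A. \<forall>Z\<in>vector_fields A. \<forall>p.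
       X p (\<lambda>q. g q (Y q) (Z q)) = g p (D X Y p) (Z p) + g p (Y p) (D X Z p))"

definition almost_contact_metric ::
    "('a::{t2_space, second_countable_topology}, 'e::euclidean_space) atlas \<Rightarrow>
     ('a \<Rightarrow> 'a tvec \<Rightarrow> 'a tvec \<Rightarrow> real) \<Rightarrow>
     ('a \<Rightarrow> 'a tvec \<Rightarrow> 'a tvec) \<Rightarrow> ('a \<Rightarrow> 'a tvec) \<Rightarrow> ('a \<Rightarrow> 'a tvec \<Rightarrow> real) \<Rightarrow> bool"
  where "almost_contact_metric A g \<phi> \<xi> \<eta> \<longleftrightarrow>
    smooth_manifold A \<and> (\<exists>n. DIM('e) = 2 * n + 1) \<and> riemannian_metric A g \<and>
    (\<forall>p. linear_on_set (tangent_space A p) (\<phi> p) \<and>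
         \<phi> p ` tangent_space A p \<subseteq> tangent_space A p) \<and>
    (\<forall>X\<in>vector_fields A. (\<lambda>p. \<phi> p (X p)) \<in> vector_fields A) \<and>
    \<xi> \<in> vector_fields A \<and>
    (\<forall>p. linear_on_set (tangent_space A p) (\<eta> p)) \<and>
    (\<forall>X\<in>vector_fields A. (\<lambda>p. \<eta> p (X p)) \<in> smooth_functions A) \<and>
    (\<forall>p. \<eta> p (\<xi> p) = 1 \<and> \<phi> p (\<xi> p) = 0) \<and>
    (\<forall>p. \<forall>v\<in>tangent_space A p.
       \<phi> p (\<phi> p v) = - v + \<eta> p v *\<^sub>R \<xi> p \<and>
       \<eta> p (\<phi> p v) = 0 \<and>
       \<eta> p v = g p v (\<xi> p) \<and>
       (\<forall>w\<in>tangent_space A p. g p (\<phi> p v) (\<phi> p w) = g p v w - \<eta> p v * \<eta> p w))"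

definition kenmotsu_manifold ::
    "('a::{t2_space, second_countable_topology}, 'e::euclidean_space) atlas \<Rightarrow>
     ('a \<Rightarrow> 'a tvec \<Rightarrow> 'a tvec \<Rightarrow> real) \<Rightarrow>
     ('a \<Rightarrow> 'a tvec \<Rightarrow> 'a tvec) \<Rightarrow> ('a \<Rightarrow> 'a tvec) \<Rightarrow> ('a \<Rightarrow> 'a tvec \<Rightarrow> real) \<Rightarrow>
     (('a \<Rightarrow> 'a tvec) \<Rightarrow> ('a \<Rightarrow> 'a tvec) \<Rightarrow> 'a \<Rightarrow> 'a tvec) \<Rightarrow> bool"
  where "kenmotsu_manifold A g \<phi> \<xi> \<eta> D \<longleftrightarrow>
    almost_contact_metric A g \<phi> \<xi> \<eta> \<and> levi_civita A g D \<and>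
    (\<forall>X\<in>vector_fields A. \<forall>Y\<in>vector_fields A. \<forall>p.
       D X (\<lambda>q. \<phi> q (Y q)) p - \<phi> p (D X Y p) =
         g p (\<phi> p (X p)) (Y p) *\<^sub>R \<xi> p - \<eta> p (Y p) *\<^sub>R \<phi> p (X p)) \<and>
    (\<forall>X\<in>vector_fields A. \<forall>p. D X \<xi> p = X p - \<eta> p (X p) *\<^sub>R \<xi> p)"

text \<open>A submanifold is an immersion \<open>f\<close> of a manifold with atlas \<open>B\<close>; embedded submanifolds are
  the case where \<open>f\<close> is the inclusion.  Tangent vectors of the submanifold at \<open>q\<close> are identified
  with their images in the ambient tangent space at \<open>f q\<close>, and the induced metric is the
  restriction of \<open>g (f q)\<close> to these images.\<close>

definition immersed_submanifold ::
    "('b::{t2_space, second_countable_topology}, 'm::euclidean_space) atlas \<Rightarrow>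
     ('a::topological_space, 'e::euclidean_space) atlas \<Rightarrow> ('b \<Rightarrow> 'a) \<Rightarrow> bool"
  where "immersed_submanifold B A f \<longleftrightarrow> smooth_manifold B \<and> smooth_map B A f \<and>
    (\<forall>q. inj_on (differential B A f) (tangent_space B q))"

definition sub_tangent ::
    "('b, 'm::euclidean_space) atlas \<Rightarrow> ('a, 'e::euclidean_space) atlas \<Rightarrow> ('b \<Rightarrow> 'a) \<Rightarrow>
     'b \<Rightarrow> 'a tvec set"
  where "sub_tangent B A f q = differential B A f ` tangent_space B q"

definition sub_normal ::
    "('b, 'm::euclidean_space) atlas \<Rightarrow> ('a, 'e::euclidean_space) atlas \<Rightarrow> ('b \<Rightarrow> 'a) \<Rightarrow>
     ('a \<Rightarrow> 'a tvec \<Rightarrow> 'a tvec \<Rightarrow> real) \<Rightarrow> 'b \<Rightarrow> 'a tvec set"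
  where "sub_normal B A f g q =
    {w \<in> tangent_space A (f q). \<forall>v\<in>sub_tangent B A f q. g (f q) w v = 0}"

definition tangential_part ::
    "('b, 'm::euclidean_space) atlas \<Rightarrow> ('a, 'e::euclidean_space) atlas \<Rightarrow> ('b \<Rightarrow> 'a) \<Rightarrow>
     ('a \<Rightarrow> 'a tvec \<Rightarrow> 'a tvec \<Rightarrow> real) \<Rightarrow> 'b \<Rightarrow> 'a tvec \<Rightarrow> 'a tvec"
  where "tangential_part B A f g q w =
    (THE t. t \<in> sub_tangent B A f q \<and> w - t \<in> sub_normal B A f g q)"

definition normal_part ::
    "('b, 'm::euclidean_space) atlas \<Rightarrow> ('a, 'e::euclidean_space) atlas \<Rightarrow> ('b \<Rightarrow> 'a) \<Rightarrow>
     ('a \<Rightarrow> 'a tvec \<Rightarrow> 'a tvec \<Rightarrow> real) \<Rightarrow> 'b \<Rightarrow> 'a tvec \<Rightarrow> 'a tvec"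
  where "normal_part B A f g q w = w - tangential_part B A f g q w"

text \<open>The Gauss formula, read at a point \<open>q\<close>.  Near \<open>q\<close> an immersion is an embedding, so every
  pair of vector fields on the submanifold is, near \<open>q\<close>, the restriction of a pair \<open>X\<close>, \<open>Y\<close> of
  ambient vector fields tangent to it, and every pair of tangent vectors at \<open>q\<close> arises as
  values of such \<open>X\<close>, \<open>Y\<close>.  The tangential part of \<open>D X Y\<close> is the induced connection and the
  normal part is the second fundamental form.  As the latter is tensorial, the formula
  determines \<open>h q\<close> on the tangent space of the submanifold at \<open>q\<close>.\<close>

definition second_fundamental_form ::
    "('b::topological_space, 'm::euclidean_space) atlas \<Rightarrow> ('a, 'e::euclidean_space) atlas \<Rightarrow>
     ('b \<Rightarrow> 'a) \<Rightarrow> ('a \<Rightarrow> 'a tvec \<Rightarrow> 'a tvec \<Rightarrow> real) \<Rightarrow>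
     (('a \<Rightarrow> 'a tvec) \<Rightarrow> ('a \<Rightarrow> 'a tvec) \<Rightarrow> 'a \<Rightarrow> 'a tvec) \<Rightarrow>
     ('b \<Rightarrow> 'a tvec \<Rightarrow> 'a tvec \<Rightarrow> 'a tvec) \<Rightarrow> bool"
  where "second_fundamental_form B A f g D h \<longleftrightarrow>
    (\<forall>q. \<forall>X\<in>vector_fields A. \<forall>Y\<in>vector_fields A.
       (\<forall>\<^sub>F r in nhds q. X (f r) \<in> sub_tangent B A f r \<and> Y (f r) \<in> sub_tangent B A f r) \<longrightarrow>
       h q (X (f q)) (Y (f q)) = normal_part B A f g q (D X Y (f q)))"

definition orthonormal_basis ::
    "('v \<Rightarrow> 'v \<Rightarrow> real) \<Rightarrow> 'v::real_vector set \<Rightarrow> 'v set \<Rightarrow> bool"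
  where "orthonormal_basis b S E \<longleftrightarrow> finite E \<and> span E = S \<and>
    (\<forall>v\<in>E. \<forall>w\<in>E. b v w = (if v = w then 1 else 0))"

text \<open>The trace of \<open>h q\<close> does not depend on the orthonormal basis chosen.\<close>

definition mean_curvature ::
    "('b, 'm::euclidean_space) atlas \<Rightarrow> ('a, 'e::euclidean_space) atlas \<Rightarrow> ('b \<Rightarrow> 'a) \<Rightarrow>
     ('a \<Rightarrow> 'a tvec \<Rightarrow> 'a tvec \<Rightarrow> real) \<Rightarrow>
     ('b \<Rightarrow> 'a tvec \<Rightarrow> 'a tvec \<Rightarrow> 'a tvec) \<Rightarrow> 'b \<Rightarrow> 'a tvec"
  where "mean_curvature B A f g h q =
    (1 / real DIM('m)) *\<^sub>R
      (\<Sum>e \<in> (SOME E. orthonormal_basis (g (f q)) (sub_tangent B A f q) E). h q e e)"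

definition totally_umbilical ::
    "('b, 'm::euclidean_space) atlas \<Rightarrow> ('a, 'e::euclidean_space) atlas \<Rightarrow> ('b \<Rightarrow> 'a) \<Rightarrow>
     ('a \<Rightarrow> 'a tvec \<Rightarrow> 'a tvec \<Rightarrow> real) \<Rightarrow>
     ('b \<Rightarrow> 'a tvec \<Rightarrow> 'a tvec \<Rightarrow> 'a tvec) \<Rightarrow> bool"
  where "totally_umbilical B A f g h \<longleftrightarrow>
    (\<forall>q. \<forall>v\<in>sub_tangent B A f q. \<forall>w\<in>sub_tangent B A f q.
       h q v w = g (f q) v w *\<^sub>R mean_curvature B A f g h q)"

definition totally_geodesic ::
    "('b, 'm::euclidean_space) atlas \<Rightarrow> ('a, 'e::euclidean_space) atlas \<Rightarrow> ('b \<Rightarrow> 'a) \<Rightarrow>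
     ('b \<Rightarrow> 'a tvec \<Rightarrow> 'a tvec \<Rightarrow> 'a tvec) \<Rightarrow> bool"
  where "totally_geodesic B A f h \<longleftrightarrow>
    (\<forall>q. \<forall>v\<in>sub_tangent B A f q. \<forall>w\<in>sub_tangent B A f q. h q v w = 0)"

definition T_op ::
    "('b, 'm::euclidean_space) atlas \<Rightarrow> ('a, 'e::euclidean_space) atlas \<Rightarrow> ('b \<Rightarrow> 'a) \<Rightarrow>
     ('a \<Rightarrow> 'a tvec \<Rightarrow> 'a tvec \<Rightarrow> real) \<Rightarrow> ('a \<Rightarrow> 'a tvec \<Rightarrow> 'a tvec) \<Rightarrow>
     'b \<Rightarrow> 'a tvec \<Rightarrow> 'a tvec"
  where "T_op B A f g \<phi> q v = tangential_part B A f g q (\<phi> (f q) v)"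

definition F_op ::
    "('b, 'm::euclidean_space) atlas \<Rightarrow> ('a, 'e::euclidean_space) atlas \<Rightarrow> ('b \<Rightarrow> 'a) \<Rightarrow>
     ('a \<Rightarrow> 'a tvec \<Rightarrow> 'a tvec \<Rightarrow> real) \<Rightarrow> ('a \<Rightarrow> 'a tvec \<Rightarrow> 'a tvec) \<Rightarrow>
     'b \<Rightarrow> 'a tvec \<Rightarrow> 'a tvec"
  where "F_op B A f g \<phi> q v = normal_part B A f g q (\<phi> (f q) v)"

text \<open>The angle between a nonzero ambient vector \<open>w\<close> and the tangent space of the submanifold:
  the angle between \<open>w\<close> and its orthogonal projection, a right angle if the latter vanishes.\<close>

definition tangent_angle ::
    "('b, 'm::euclidean_space) atlas \<Rightarrow> ('a, 'e::euclidean_space) atlas \<Rightarrow> ('b \<Rightarrow> 'a) \<Rightarrow>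
     ('a \<Rightarrow> 'a tvec \<Rightarrow> 'a tvec \<Rightarrow> real) \<Rightarrow> 'b \<Rightarrow> 'a tvec \<Rightarrow> real"
  where "tangent_angle B A f g q w =
    (let t = tangential_part B A f g q w
     in arccos (sqrt (g (f q) t t) / sqrt (g (f q) w w)))"

definition slant ::
    "('b, 'm::euclidean_space) atlas \<Rightarrow> ('a, 'e::euclidean_space) atlas \<Rightarrow> ('b \<Rightarrow> 'a) \<Rightarrow>
     ('a \<Rightarrow> 'a tvec \<Rightarrow> 'a tvec \<Rightarrow> real) \<Rightarrow> ('a \<Rightarrow> 'a tvec \<Rightarrow> 'a tvec) \<Rightarrow>
     ('a \<Rightarrow> 'a tvec) \<Rightarrow> bool"
  where "slant B A f g \<phi> \<xi> \<longleftrightarrow>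
    (\<forall>q. \<xi> (f q) \<in> sub_tangent B A f q) \<and>
    (\<exists>\<theta>\<in>{0..pi / 2}. \<forall>q. \<forall>v \<in> sub_tangent B A f q - span {\<xi> (f q)}.
       tangent_angle B A f g q (\<phi> (f q) v) = \<theta>)"

definition invariant_sub ::
    "('b, 'm::euclidean_space) atlas \<Rightarrow> ('a, 'e::euclidean_space) atlas \<Rightarrow> ('b \<Rightarrow> 'a) \<Rightarrow>
     ('a \<Rightarrow> 'a tvec \<Rightarrow> 'a tvec \<Rightarrow> real) \<Rightarrow> ('a \<Rightarrow> 'a tvec \<Rightarrow> 'a tvec) \<Rightarrow> bool"
  where "invariant_sub B A f g \<phi> \<longleftrightarrow>
    (\<forall>q. \<forall>v\<in>sub_tangent B A f q. F_op B A f g \<phi> q v = 0)"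

definition anti_invariant_sub ::
    "('b, 'm::euclidean_space) atlas \<Rightarrow> ('a, 'e::euclidean_space) atlas \<Rightarrow> ('b \<Rightarrow> 'a) \<Rightarrow>
     ('a \<Rightarrow> 'a tvec \<Rightarrow> 'a tvec \<Rightarrow> real) \<Rightarrow> ('a \<Rightarrow> 'a tvec \<Rightarrow> 'a tvec) \<Rightarrow> bool"
  where "anti_invariant_sub B A f g \<phi> \<longleftrightarrow>
    (\<forall>q. \<forall>v\<in>sub_tangent B A f q. T_op B A f g \<phi> q v = 0)"

definition proper_slant ::
    "('b, 'm::euclidean_space) atlas \<Rightarrow> ('a, 'e::euclidean_space) atlas \<Rightarrow> ('b \<Rightarrow> 'a) \<Rightarrow>
     ('a \<Rightarrow> 'a tvec \<Rightarrow> 'a tvec \<Rightarrow> real) \<Rightarrow> ('a \<Rightarrow> 'a tvec \<Rightarrow> 'a tvec) \<Rightarrow>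
     ('a \<Rightarrow> 'a tvec) \<Rightarrow> bool"
  where "proper_slant B A f g \<phi> \<xi> \<longleftrightarrow> slant B A f g \<phi> \<xi> \<and>
    \<not> invariant_sub B A f g \<phi> \<and> \<not> anti_invariant_sub B A f g \<phi>"

definition mu_bundle ::
    "('b, 'm::euclidean_space) atlas \<Rightarrow> ('a, 'e::euclidean_space) atlas \<Rightarrow> ('b \<Rightarrow> 'a) \<Rightarrow>
     ('a \<Rightarrow> 'a tvec \<Rightarrow> 'a tvec \<Rightarrow> real) \<Rightarrow> ('a \<Rightarrow> 'a tvec \<Rightarrow> 'a tvec) \<Rightarrow>
     'b \<Rightarrow> 'a tvec set"
  where "mu_bundle B A f g \<phi> q =
    {w \<in> sub_normal B A f g q. \<forall>v\<in>sub_tangent B A f q. g (f q) w (F_op B A f g \<phi> q v) = 0}"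

text \<open>\<open>E q\<close> is a subspace of the ambient tangent space at the image of \<open>q\<close>; smoothness of the
  section along the immersion is tested on ambient smooth functions.\<close>

definition smooth_sections ::
    "('b, 'm::euclidean_space) atlas \<Rightarrow> ('a, 'e::euclidean_space) atlas \<Rightarrow>
     ('b \<Rightarrow> 'a tvec set) \<Rightarrow> ('b \<Rightarrow> 'a tvec) set"
  where "smooth_sections B A E = {N.
    (\<forall>q. N q \<in> E q) \<and> (\<forall>u\<in>smooth_functions A. (\<lambda>q. N q u) \<in> smooth_functions B)}"

end

theory Submission
  imports Defs
begin

text \<open>Every submanifold satisfying the hypotheses is totally geodesic.  The Kenmotsu condition
  \<open>D X \<xi> = X - \<eta> X \<xi>\<close> at \<open>X = \<xi>\<close> says that the integral curves of \<open>\<xi>\<close> are geodesics: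
  \<open>D \<xi> \<xi> = 0\<close>.  Since slant submanifolds have \<open>\<xi>\<close> tangent to them, the Gauss formula may be
  read along \<open>\<xi>\<close> and gives \<open>h \<xi> \<xi> = 0\<close>.  Umbilicity turns this into
  \<open>g \<xi> \<xi> H = 0\<close>, and \<open>\<xi>\<close> is a unit vector, so \<open>H = 0\<close> and hence \<open>h = 0\<close>.

  The one analytic point is hidden in the Gauss formula.  Normal parts are defined by a unique
  orthogonal decomposition, and even for the zero vector the existence of this decomposition uses
  that vectors tangent to the submanifold are tangent vectors of the ambient manifold, on which
  the metric is bilinear.  For tangent vectors as derivations this means that pulling back along
  the immersion takes smooth functions to smooth functions (lemma
  \<open>smooth_functions_compose\<close>), so most of the work is the chain rule of order \<open>k\<close>
  (lemma \<open>times_differentiable_on_compose\<close>).\<close>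

section \<open>Functions that are differentiable several times\<close>

text \<open>At a point of an open set, having a given derivative depends only on the values of the
  function on that set; this also covers the arbitrary value that the Frechet derivative takes
  where the function is not differentiable.\<close>

lemma times_differentiable_on_cong:
  assumes "open S" "\<And>x. x \<in> S \<Longrightarrow> f x = g x"
  shows "times_differentiable_on k S f \<longleftrightarrow> times_differentiable_on k S g"
  using assms(2)
proof (induction k arbitrary: f g)
  case 0
  then show ?case by (simp cong: continuous_on_cong)
next
  case (Suc k)
  have derivative: "(f has_derivative f') (at x) \<longleftrightarrow> (g has_derivative f') (at x)"
    if "x \<in> S" for x f'
    using has_derivative_transform_within_open[OF _ \<open>open S\<close> that, of f f' UNIV g]
      has_derivative_transform_within_open[OF _ \<open>open S\<close> that, of g f' UNIV f] Suc.prems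
    by auto
  then have "frechet_derivative f (at x) = frechet_derivative g (at x)" if "x \<in> S" for x
    using that by (simp add: frechet_derivative_def)
  then have "times_differentiable_on k S (\<lambda>x. frechet_derivative f (at x) v) \<longleftrightarrow>
      times_differentiable_on k S (\<lambda>x. frechet_derivative g (at x) v)" for v
    by (intro Suc.IH) simp
  with derivative show ?case
    by (simp add: differentiable_def)
qed

lemma times_differentiable_on_local:
  assumes "\<And>x. x \<in> S \<Longrightarrow> \<exists>T. open T \<and> x \<in> T \<and> times_differentiable_on k T f"
  shows "times_differentiable_on k S f"
  using assms
proof (induction k arbitrary: f)
  case 0
  have "continuous (at x) f" if "x \<in> S" for x
    using 0[OF that] continuous_on_eq_continuous_at by auto
  then show ?case
    by (simp add: continuous_at_imp_continuous_on)
next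
  case (Suc k)
  have "times_differentiable_on k S (\<lambda>x. frechet_derivative f (at x) v)" for v
    using Suc.prems by (intro Suc.IH) fastforce
  moreover have "f differentiable (at x)" if "x \<in> S" for x
    using Suc.prems[OF that] by auto
  ultimately show ?case
    by simp
qed

lemma times_differentiable_on_SucI:
  assumes "open S" "\<And>x. x \<in> S \<Longrightarrow> (f has_derivative f' x) (at x)"
    and "\<And>v. times_differentiable_on k S (\<lambda>x. f' x v)"
  shows "times_differentiable_on (Suc k) S f"
proof -
  have "f' x = frechet_derivative f (at x)" if "x \<in> S" for x
    using frechet_derivative_at assms(2) that by blast
  then have "times_differentiable_on k S (\<lambda>x. frechet_derivative f (at x) v)" for v
    using assms(3)[of v] times_differentiable_on_cong[OF assms(1), of "\<lambda>x. f' x v"] by simp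
  then show ?thesis
    using assms(2) by (auto simp: differentiable_def)
qed

lemma times_differentiable_on_Suc_has_derivative:
  assumes "times_differentiable_on (Suc k) S f" "x \<in> S"
  shows "(f has_derivative frechet_derivative f (at x)) (at x)"
  using assms frechet_derivative_works by auto

lemma times_differentiable_on_Suc_imp:
  "times_differentiable_on (Suc k) S f \<Longrightarrow> times_differentiable_on k S f"
proof (induction k arbitrary: f)
  case 0
  then show ?case
    by (auto intro!: continuous_at_imp_continuous_on differentiable_imp_continuous_within)
next
  case (Suc k)
  from Suc.prems have "times_differentiable_on k S (\<lambda>x. frechet_derivative f (at x) v)" for v
    by (intro Suc.IH) simp
  with Suc.prems show ?case
    by simp
qed

lemma times_differentiable_on_const:
  "times_differentiable_on k S (\<lambda>x. a)"
  by (induction k arbitrary: a) (simp_all add: frechet_derivative_const)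

lemma times_differentiable_on_add:
  assumes "open S" "times_differentiable_on k S f" "times_differentiable_on k S g"
  shows "times_differentiable_on k S (\<lambda>x. f x + g x)"
  using assms(2,3)
proof (induction k arbitrary: f g)
  case 0
  then show ?case by (simp add: continuous_on_add)
next
  case (Suc k)
  show ?case
  proof (rule times_differentiable_on_SucI[OF \<open>open S\<close>])
    show "((\<lambda>x. f x + g x) has_derivative
        (\<lambda>v. frechet_derivative f (at x) v + frechet_derivative g (at x) v)) (at x)"
      if "x \<in> S" for x
      using Suc.prems that
      by (intro has_derivative_add times_differentiable_on_Suc_has_derivative)
  qed (use Suc in simp)
qed

lemma times_differentiable_on_sum:
  assumes "open S" "\<And>i. i \<in> I \<Longrightarrow> times_differentiable_on k S (f i)"
  shows "times_differentiable_on k S (\<lambda>x. \<Sum>i\<in>I. f i x)"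
  using assms(2)
  by (induction I rule: infinite_finite_induct)
    (auto intro: times_differentiable_on_const times_differentiable_on_add[OF \<open>open S\<close>])

lemma times_differentiable_on_mult:
  fixes f g :: "_ \<Rightarrow> real"
  assumes "open S" "times_differentiable_on k S f" "times_differentiable_on k S g"
  shows "times_differentiable_on k S (\<lambda>x. f x * g x)"
  using assms(2,3)
proof (induction k arbitrary: f g)
  case 0
  then show ?case by (simp add: continuous_on_mult)
next
  case (Suc k)
  show ?case
  proof (rule times_differentiable_on_SucI[OF \<open>open S\<close>])
    show "((\<lambda>x. f x * g x) has_derivative
        (\<lambda>v. f x * frechet_derivative g (at x) v + frechet_derivative f (at x) v * g x)) (at x)"
      if "x \<in> S" for x
      using Suc.prems that
      by (intro has_derivative_mult times_differentiable_on_Suc_has_derivative)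
    have "times_differentiable_on k S f" "times_differentiable_on k S g"
      using Suc.prems times_differentiable_on_Suc_imp by blast+
    then show "times_differentiable_on k S
        (\<lambda>x. f x * frechet_derivative g (at x) v + frechet_derivative f (at x) v * g x)" for v
      using Suc by (intro times_differentiable_on_add[OF \<open>open S\<close>] Suc.IH) auto
  qed
qed

lemma times_differentiable_on_inner_left:
  assumes "open S" "times_differentiable_on k S f"
  shows "times_differentiable_on k S (\<lambda>x. f x \<bullet> b)"
  using assms(2)
proof (induction k arbitrary: f)
  case 0
  then show ?case by (simp add: continuous_on_inner)
next
  case (Suc k)
  show ?case
  proof (rule times_differentiable_on_SucI[OF \<open>open S\<close>])
    show "((\<lambda>x. f x \<bullet> b) has_derivative (\<lambda>v. frechet_derivative f (at x) v \<bullet> b)) (at x)"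
      if "x \<in> S" for x
      using Suc.prems that
      by (intro has_derivative_inner_left times_differentiable_on_Suc_has_derivative)
  qed (use Suc in simp)
qed

text \<open>Expanding the inner derivative in a basis writes the derivative of a composition as a finite
  sum of products of lower-order compositions, which is what lets the induction on the order of
  differentiability close.\<close>

lemma times_differentiable_on_compose:
  fixes F :: "'e::real_normed_vector \<Rightarrow> 'd::euclidean_space" and u :: "'d \<Rightarrow> real"
  assumes "open S" "F ` S \<subseteq> T"
    and "times_differentiable_on k S F" "times_differentiable_on k T u"
  shows "times_differentiable_on k S (\<lambda>x. u (F x))"
  using assms(3,4)
proof (induction k arbitrary: u)
  case 0
  then show ?case
    using continuous_on_compose2 assms(2) by auto
next
  case (Suc k)
  let ?F' = "\<lambda>x. frechet_derivative F (at x)" and ?u' = "\<lambda>y. frechet_derivative u (at y)"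
  show ?case
  proof (rule times_differentiable_on_SucI[OF \<open>open S\<close>])
    fix x assume "x \<in> S"
    then have F': "(F has_derivative ?F' x) (at x)"
      and u': "(u has_derivative ?u' (F x)) (at (F x))"
      using Suc.prems assms(2) times_differentiable_on_Suc_has_derivative by blast+
    have "?u' (F x) (?F' x v) = (\<Sum>b\<in>Basis. (?F' x v \<bullet> b) * ?u' (F x) b)" for v
    proof -
      have "?u' (F x) (?F' x v) = ?u' (F x) (\<Sum>b\<in>Basis. (?F' x v \<bullet> b) *\<^sub>R b)"
        by (simp add: euclidean_representation)
      also have "\<dots> = (\<Sum>b\<in>Basis. (?F' x v \<bullet> b) * ?u' (F x) b)"
        using has_derivative_linear[OF u'] by (simp add: linear_sum linear_scale)
      finally show ?thesis .
    qed
    with has_derivative_compose[OF F' u']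
    show "((\<lambda>x. u (F x)) has_derivative
        (\<lambda>v. \<Sum>b\<in>Basis. (?F' x v \<bullet> b) * ?u' (F x) b)) (at x)"
      by simp
  next
    have F: "times_differentiable_on k S F"
      using Suc.prems times_differentiable_on_Suc_imp by blast
    have "times_differentiable_on k S (\<lambda>x. ?u' (F x) b)" for b
      using Suc.IH[OF F, of "\<lambda>y. ?u' y b"] Suc.prems by simp
    moreover have "times_differentiable_on k S (\<lambda>x. ?F' x v \<bullet> b)" for v b
      using Suc.prems by (intro times_differentiable_on_inner_left[OF \<open>open S\<close>]) simp
    ultimately show
      "times_differentiable_on k S (\<lambda>x. \<Sum>b\<in>Basis. (?F' x v \<bullet> b) * ?u' (F x) b)" for v
      by (intro times_differentiable_on_sum[OF \<open>open S\<close>]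
          times_differentiable_on_mult[OF \<open>open S\<close>])
  qed
qed

section \<open>Smooth functions on manifolds and their pullbacks\<close>

lemma smooth_manifold_open_image:
  "smooth_manifold A \<Longrightarrow> (U, c) \<in> A \<Longrightarrow> open (c ` U)"
  by (auto simp: smooth_manifold_def)

lemma smooth_functions_iff:
  "u \<in> smooth_functions A \<longleftrightarrow>
    (\<forall>U c k. (U, c) \<in> A \<longrightarrow> times_differentiable_on k (c ` U) (\<lambda>x. u (inv_into U c x)))"
  by (auto simp: smooth_functions_def smooth_on_def o_def)

lemma smooth_functions_add:
  assumes "smooth_manifold A" "u \<in> smooth_functions A" "w \<in> smooth_functions A"
  shows "u + w \<in> smooth_functions A"
  using assms unfolding smooth_functions_iff plus_fun_def
  by (intro allI impI times_differentiable_on_add smooth_manifold_open_image) auto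

lemma smooth_functions_mult:
  assumes "smooth_manifold A" "u \<in> smooth_functions A" "w \<in> smooth_functions A"
  shows "u * w \<in> smooth_functions A"
  using assms unfolding smooth_functions_iff times_fun_def
  by (intro allI impI times_differentiable_on_mult smooth_manifold_open_image) auto

lemma smooth_functions_scaleR:
  assumes "smooth_manifold A" "u \<in> smooth_functions A"
  shows "r *\<^sub>R u \<in> smooth_functions A"
  using assms unfolding smooth_functions_iff scaleR_fun_def real_scaleR_def
  by (intro allI impI times_differentiable_on_mult times_differentiable_on_const
      smooth_manifold_open_image) auto

lemma homeomorphism_imp_inj_on: "homeomorphism S T f g \<Longrightarrow> inj_on f S"
  by (metis homeomorphism_apply1 inj_onI)

text \<open>Smoothness is local, so it can be tested near the image under a chart \<open>c\<close> of a given point.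
  There \<open>u \<circ> f \<circ> c\<^sup>-\<^sup>1\<close> factors through an ambient chart \<open>d\<close> as
  \<open>(u \<circ> d\<^sup>-\<^sup>1) \<circ> (d \<circ> f \<circ> c\<^sup>-\<^sup>1)\<close>.\<close>

lemma smooth_functions_compose:
  fixes A :: "('a::{t2_space, second_countable_topology}, 'e::euclidean_space) atlas"
    and B :: "('b::{t2_space, second_countable_topology}, 'm::euclidean_space) atlas"
  assumes A: "smooth_manifold A" and B: "smooth_manifold B" and f: "smooth_map B A f"
    and u: "u \<in> smooth_functions A"
  shows "u \<circ> f \<in> smooth_functions B"
proof -
  have "times_differentiable_on k (c ` U) (\<lambda>x. u (f (inv_into U c x)))"
    if "(U, c) \<in> B" for U c k
  proof (rule times_differentiable_on_local)
    have open_U: "open U" "open (c ` U)" and homeo: "homeomorphism U (c ` U) c (inv_into U c)"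
      using B that by (auto simp: smooth_manifold_def)
    fix x assume x: "x \<in> c ` U"
    obtain V d where V: "(V, d) \<in> A" "f (inv_into U c x) \<in> V"
      using A unfolding smooth_manifold_def by blast
    let ?W = "c ` (U \<inter> f -` V)"
    have "open V" and "homeomorphism V (d ` V) d (inv_into V d)"
      using A V(1) by (auto simp: smooth_manifold_def)
    then have inj_d: "inj_on d V"
      using homeomorphism_imp_inj_on by blast
    then have "open (f -` V)"
      using f \<open>open V\<close> by (intro open_vimage) (auto simp: smooth_map_def)
    then have "openin (top_of_set (c ` U)) ?W"
      by (intro homeomorphism_imp_open_map[OF homeo])
        (auto simp: openin_open_eq[OF open_U(1)] open_U(1))
    then have "open ?W"
      using open_U(2) openin_open_eq by blast
    moreover have "x \<in> ?W"
      using x V(2)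
      by (auto simp: f_inv_into_f inv_into_into intro!: rev_image_eqI[of "inv_into U c x"])
    moreover have "times_differentiable_on k ?W (\<lambda>x. u (f (inv_into U c x)))"
    proof -
      have inj_c: "inj_on c U"
        using homeo homeomorphism_imp_inj_on by blast
      let ?F = "\<lambda>x. d (f (inv_into U c x))"
      have "times_differentiable_on k ?W ?F"
        using f that V(1) unfolding smooth_map_def smooth_on_def o_def by blast
      moreover have "times_differentiable_on k (d ` V) (\<lambda>y. u (inv_into V d y))"
        using u V(1) by (simp add: smooth_functions_iff)
      moreover have "?F ` ?W \<subseteq> d ` V"
        using inj_c by auto
      ultimately have "times_differentiable_on k ?W (\<lambda>x. u (inv_into V d (?F x)))"
        using times_differentiable_on_compose[OF \<open>open ?W\<close>] by blast
      moreover have "u (f (inv_into U c x)) = u (inv_into V d (?F x))" if "x \<in> ?W" for x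
        using that inj_c inj_d by auto
      ultimately show ?thesis
        by (subst times_differentiable_on_cong[OF \<open>open ?W\<close>]) simp_all
    qed
    ultimately show "\<exists>T. open T \<and> x \<in> T \<and>
        times_differentiable_on k T (\<lambda>x. u (f (inv_into U c x)))"
      by blast
  qed
  then show ?thesis
    by (simp add: smooth_functions_iff)
qed

section \<open>Tangent vectors of a submanifold\<close>

lemma zero_in_tangent_space: "0 \<in> tangent_space A p"
  by (simp add: tangent_space_def linear_on_set_def)

lemma uminus_in_tangent_space: "v \<in> tangent_space A p \<Longrightarrow> - v \<in> tangent_space A p"
  by (simp add: tangent_space_def linear_on_set_def)

lemma differential_in_tangent_space:
  assumes A: "smooth_manifold A" and B: "smooth_manifold B" and f: "smooth_map B A f"
    and v: "v \<in> tangent_space B q"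
  shows "differential B A f v \<in> tangent_space A (f q)"
proof -
  have pullback_ops: "(u + w) \<circ> f = (u \<circ> f) + (w \<circ> f)" "(u * w) \<circ> f = (u \<circ> f) * (w \<circ> f)"
    "(r *\<^sub>R u) \<circ> f = r *\<^sub>R (u \<circ> f)" for u w :: "'a \<Rightarrow> real" and r
    by (simp_all add: fun_eq_iff scaleR_fun_def)
  show ?thesis
    using v
    by (auto simp: tangent_space_def linear_on_set_def differential_def pullback_ops
        smooth_functions_compose[OF A B f] smooth_functions_add[OF A]
        smooth_functions_mult[OF A] smooth_functions_scaleR[OF A])
qed

lemma sub_tangent_subset_tangent_space:
  assumes "smooth_manifold A" "immersed_submanifold B A f"
  shows "sub_tangent B A f q \<subseteq> tangent_space A (f q)"
  using assms differential_in_tangent_space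
  by (auto simp: sub_tangent_def immersed_submanifold_def)

text \<open>The definite description in the tangential part has to be shown to denote: zero is orthogonal
  to the tangent space by bilinearity, and a second decomposition would give a vector orthogonal to
  itself.\<close>

lemma normal_part_zero:
  assumes A: "smooth_manifold A" and g: "riemannian_metric A g"
    and f: "immersed_submanifold B A f"
  shows "normal_part B A f g q 0 = 0"
proof -
  have metric_sym: "g (f q) v w = g (f q) w v"
    if "v \<in> tangent_space A (f q)" "w \<in> tangent_space A (f q)" for v w
    using g that by (simp add: riemannian_metric_def)
  have metric_scaleR: "g (f q) v (r *\<^sub>R w) = r * g (f q) v w"
    if "v \<in> tangent_space A (f q)" "w \<in> tangent_space A (f q)" for v w r
    using g that by (simp add: riemannian_metric_def linear_on_set_def)
  have metric_zero: "g (f q) v 0 = 0" if "v \<in> tangent_space A (f q)" for v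
    using metric_scaleR[OF that zero_in_tangent_space, of 0] by simp
  have "0 \<in> sub_tangent B A f q"
    unfolding sub_tangent_def
    by (rule image_eqI[OF _ zero_in_tangent_space]) (simp add: differential_def fun_eq_iff)
  moreover have "0 \<in> sub_normal B A f g q"
  proof -
    have "g (f q) 0 v = 0" if "v \<in> sub_tangent B A f q" for v
    proof -
      have "v \<in> tangent_space A (f q)"
        using that sub_tangent_subset_tangent_space[OF A f] by blast
      then show ?thesis
        using metric_sym[OF zero_in_tangent_space] metric_zero by simp
    qed
    then show ?thesis
      by (simp add: sub_normal_def zero_in_tangent_space)
  qed
  moreover have "t = 0" if t: "t \<in> sub_tangent B A f q" and "0 - t \<in> sub_normal B A f g q" for t
  proof -
    have t': "t \<in> tangent_space A (f q)"
      using t sub_tangent_subset_tangent_space[OF A f] by blast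
    have "0 = g (f q) (- t) t"
      using that by (simp add: sub_normal_def)
    also have "\<dots> = g (f q) t (- t)"
      using metric_sym[OF uminus_in_tangent_space[OF t'] t'] .
    also have "\<dots> = - g (f q) t t"
      using metric_scaleR[OF t' t', of "- 1"] by simp
    finally show "t = 0"
      using g t' unfolding riemannian_metric_def by fastforce
  qed
  ultimately have "tangential_part B A f g q 0 = 0"
    unfolding tangential_part_def by (intro the_equality) auto
  then show ?thesis
    by (simp add: normal_part_def)
qed

section \<open>Umbilical submanifolds tangent to the structure vector field\<close>

text \<open>Under umbilicity the mean curvature is the value of \<open>h\<close> on
  any pair of equal unit tangent vectors.  The structure vector field consists of unit vectors and
  is autoparallel in the ambient manifold, so that this value is a normal part of zero.\<close>

lemma totally_umbilical_imp_totally_geodesic: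
  assumes kenmotsu: "kenmotsu_manifold A g \<phi> \<xi> \<eta> D"
    and f: "immersed_submanifold B A f"
    and h: "second_fundamental_form B A f g D h"
    and umbilical: "totally_umbilical B A f g h"
    and tangent: "\<And>q. \<xi> (f q) \<in> sub_tangent B A f q"
  shows "totally_geodesic B A f h"
proof -
  have A: "smooth_manifold A" and g: "riemannian_metric A g" and \<xi>: "\<xi> \<in> vector_fields A"
    and unit: "\<eta> p (\<xi> p) = 1"
    and \<eta>: "v \<in> tangent_space A p \<Longrightarrow> \<eta> p v = g p v (\<xi> p)"
    and "D \<xi> \<xi> p = \<xi> p - \<eta> p (\<xi> p) *\<^sub>R \<xi> p" for p v
    using kenmotsu by (auto simp: kenmotsu_manifold_def almost_contact_metric_def)
  then have D\<xi>: "D \<xi> \<xi> p = 0" for p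
    by simp
  have "mean_curvature B A f g h q = 0" for q
  proof -
    have "\<xi> (f q) \<in> tangent_space A (f q)"
      using \<xi> by (simp add: vector_fields_def)
    then have "g (f q) (\<xi> (f q)) (\<xi> (f q)) = 1"
      using \<eta> unit by metis
    then have "mean_curvature B A f g h q = h q (\<xi> (f q)) (\<xi> (f q))"
      using umbilical tangent by (simp add: totally_umbilical_def)
    also have "\<dots> = normal_part B A f g q (D \<xi> \<xi> (f q))"
      using h \<xi> tangent by (simp add: second_fundamental_form_def)
    also have "\<dots> = 0"
      by (simp add: D\<xi> normal_part_zero[OF A g f])
    finally show ?thesis .
  qed
  then show ?thesis
    using umbilical by (simp add: totally_umbilical_def totally_geodesic_def)
qed

theorem theorem3p2:
  fixes A :: "('a::{t2_space, second_countable_topology}, 'e::euclidean_space) atlas"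
    and g :: "'a \<Rightarrow> 'a tvec \<Rightarrow> 'a tvec \<Rightarrow> real"
    and \<phi> :: "'a \<Rightarrow> 'a tvec \<Rightarrow> 'a tvec"
    and \<xi> :: "'a \<Rightarrow> 'a tvec"
    and \<eta> :: "'a \<Rightarrow> 'a tvec \<Rightarrow> real"
    and D :: "('a \<Rightarrow> 'a tvec) \<Rightarrow> ('a \<Rightarrow> 'a tvec) \<Rightarrow> 'a \<Rightarrow> 'a tvec"
    and B :: "('b::{t2_space, second_countable_topology}, 'm::euclidean_space) atlas"
    and f :: "'b \<Rightarrow> 'a"
    and h :: "'b \<Rightarrow> 'a tvec \<Rightarrow> 'a tvec \<Rightarrow> 'a tvec"
  assumes "kenmotsu_manifold A g \<phi> \<xi> \<eta> D"
    and "immersed_submanifold B A f"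
    and "second_fundamental_form B A f g D h"
    and "totally_umbilical B A f g h"
    and "slant B A f g \<phi> \<xi>"
  shows "invariant_sub B A f g \<phi> \<or>
    anti_invariant_sub B A f g \<phi> \<or>
    totally_geodesic B A f h \<or>
    DIM('m) = 1 \<or>
    (proper_slant B A f g \<phi> \<xi> \<longrightarrow>
      mean_curvature B A f g h \<in> smooth_sections B A (mu_bundle B A f g \<phi>))"
proof -
  have "totally_geodesic B A f h"
    using totally_umbilical_imp_totally_geodesic[OF assms(1-4)] assms(5)
    by (simp add: slant_def)
  then show ?thesis
    by blast
qed

end
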